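(* Let $\lambda$ be an infinite cardinal and let $(X,\mathbf{X})$ be a $\lambda$-lifter of a poset $P$, with norm $\partial$. Put $\kappa:=\mathrm{card}\,\mathbf{X}$. Then the following statements hold: (1) $P\setminus\mathrm{Max}\,P$ is lower $\mathrm{cf}(\lambda)$-small, where $\mathrm{Max}\,P$ is the set of maximal elements of $P$. (2) $P$ is an almost join-semilattice. (3) $P$ is the disjoint union of finitely many posets with zero. (4) For every isotone map $f\colon[\mathbf{X}^{=}]^{<\mathrm{cf}(\lambda)}\to[\mathbf{X}]^{<\lambda}$, there exists an isotone section $\sigma\colon P\hookrightarrow\mathbf{X}$ of $\partial$ (i.e., $\partial\sigma(p)=p$ for all $p\in P$) such that $f(\sigma[P\downarrow a])\cap\sigma[P\downarrow b]\subseteq\sigma[P\downarrow a]$ for all $a<b$ in $P$. (5) For every isotone map $f\colon[\kappa]^{<\mathrm{cf}(\lambda)}\to[\kappa]^{<\lambda}$, there exists a one-to-one map $\sigma\colon P\rightarrowtail\kappa$ such that $f(\sigma[P\downarrow a])\cap\sigma[P\downarrow b]\subseteq\sigma[P\downarrow a]$ for all $a<b$ in $P$.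
   Context: All posets are nonempty. $P\downarrow a=\{p\in P\mid p\le a\}$; $\sigma[Z]$ is the image of $Z$ under $\sigma$. $[Y]^{<\kappa}$ is the set of subsets of $Y$ of cardinality $<\kappa$, ordered by inclusion. A poset $Q$ (or subset of a poset, with induced order) is lower $\kappa$-small if $\mathrm{card}(Q\downarrow a)<\kappa$ for each $a\in Q$. A poset is the disjoint union of a family of subposets if it is their union and elements of distinct members are incomparable. "With zero" means with a least element. For $Y\subseteq P$, $\nabla Y$ is the set of minimal elements of the set of upper bounds of $Y$. $P$ is a *pseudo join-semilattice* if for every $Y\subseteq P$ that is empty or has two elements, the set of upper bounds of $Y$ equals $\{p\mid(\exists g\in G)(g\le p)\}$ for some finite $G\subseteq P$; *supported* if moreover each finite subset of $P$ is contained in a finite $Z\subseteq P$ with $\nabla Y\subseteq Z$ for all finite $Y\subseteq Z$; an *almost join-semilattice* if it is a pseudo join-semilattice and $P\downarrow a$ is a join-semilattice for each $a\in P$. An *ideal* of a poset is a nonempty directed lower subset. A *norm-covering* of $P$ is a pseudo join-semilattice $X$ with an isotone map $\partial\colon X\to P$. An ideal $\mathbf{u}$ of $X$ is sharp if $\{\partial x\mid x\in\mathbf{u}\}$ has a largest element, denoted $\partial\mathbf{u}$. A *$\lambda$-lifter* of $P$ is a pair $(X,\mathbf{X})$ with $X$ a norm-covering of $P$ and $\mathbf{X}$ a set of sharp ideals of $X$ (ordered by inclusion) such that, with $\mathbf{X}^{=}=\{\mathbf{x}\in\mathbf{X}\mid\partial\mathbf{x}\text{ not maximal in }P\}$: (a)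 $\mathrm{card}\{\mathbf{y}\in\mathbf{X}\mid\mathbf{y}\subseteq\mathbf{x}\}<\mathrm{cf}(\lambda)$ for each $\mathbf{x}\in\mathbf{X}^{=}$; (b) for each map $S\colon\mathbf{X}^{=}\to[X]^{<\lambda}$ there is an isotone $\sigma\colon P\to\mathbf{X}$ with $\partial\sigma(p)=p$ for all $p$ and $S(\sigma(a))\cap\sigma(b)\subseteq\sigma(a)$ for all $a<b$ in $P$; (c) if $\lambda=\aleph_0$ then $X$ is supported. *)

theory Defs
  imports Main "HOL-Library.FuncSet"
begin

unbundle cardinal_syntax

text \<open>
  Cardinals are represented as in \<^theory>\<open>HOL.BNF_Cardinal_Order_Relation\<close>, by well-order
  relations satisfying \<^const>\<open>Card_order\<close>. A poset is a type of class \<^class>\<open>order\<close>,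
  a subposet is a subset of such a type with the induced order.
\<close>

text \<open>
  The library's \<^const>\<open>cofinal\<close> asks for strictly larger elements; over an infinite cardinal,
  which has no largest element, this is the usual notion. The choice below only picks
  a representative, the cardinal being determined up to \<open>=o\<close>.
\<close>

definition cofinality :: "'l rel \<Rightarrow> 'l rel" where
  "cofinality r =
    (SOME s. (\<exists>A \<subseteq> Field r. cofinal A r \<and> s = |A| ) \<and>
             (\<forall>B \<subseteq> Field r. cofinal B r \<longrightarrow> s \<le>o |B| ))"

lemma cofinality_props:
  assumes "Cinfinite r"
  shows "\<exists>A \<subseteq> Field r. cofinal A r \<and> cofinality r = |A|"
    and "B \<subseteq> Field r \<Longrightarrow> cofinal B r \<Longrightarrow> cofinality r \<le>o |B|"
proof -
  let ?R = "{ |A| | A. A \<subseteq> Field r \<and> cofinal A r}"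
  have "cofinal (Field r) r"
    using assms infinite_Card_order_limit[of r]
    unfolding cofinal_def cinfinite_def by blast
  then have "?R \<noteq> {}" by blast
  then obtain s where s: "s \<in> ?R" "\<forall>s' \<in> ?R. s \<le>o s'"
    using exists_minim_Card_order[of ?R] card_of_Card_order by blast
  then have "\<exists>s. (\<exists>A \<subseteq> Field r. cofinal A r \<and> s = |A| ) \<and>
      (\<forall>B \<subseteq> Field r. cofinal B r \<longrightarrow> s \<le>o |B| )" by blast
  from someI_ex[OF this, folded cofinality_def]
  show "\<exists>A \<subseteq> Field r. cofinal A r \<and> cofinality r = |A|"
    and "B \<subseteq> Field r \<Longrightarrow> cofinal B r \<Longrightarrow> cofinality r \<le>o |B|" by blast+
qed

definition small_subsets :: "'l rel \<Rightarrow> 'a set \<Rightarrow> 'a set set" where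
  "small_subsets r Y = {Z. Z \<subseteq> Y \<and> |Z| <o r}"

definition maximal_elems :: "'a::order set \<Rightarrow> 'a set" where
  "maximal_elems A = {x \<in> A. \<not> (\<exists>y \<in> A. x < y)}"

definition minimal_elems :: "'a::order set \<Rightarrow> 'a set" where
  "minimal_elems A = {x \<in> A. \<not> (\<exists>y \<in> A. y < x)}"

definition upper_bounds_in :: "'a::order set \<Rightarrow> 'a set \<Rightarrow> 'a set" where
  "upper_bounds_in A Y = {p \<in> A. \<forall>y \<in> Y. y \<le> p}"

definition nabla :: "'a::order set \<Rightarrow> 'a set \<Rightarrow> 'a set" where
  "nabla A Y = minimal_elems (upper_bounds_in A Y)"

definition lower_small :: "'l rel \<Rightarrow> 'a::order set \<Rightarrow> bool" where
  "lower_small r A \<longleftrightarrow> (\<forall>a \<in> A. |{x \<in> A. x \<le> a}| <o r)"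

definition join_semilattice :: "'a::order set \<Rightarrow> bool" where
  "join_semilattice A \<longleftrightarrow> A \<noteq> {} \<and>
    (\<forall>x \<in> A. \<forall>y \<in> A. \<exists>z \<in> upper_bounds_in A {x, y}. \<forall>w \<in> upper_bounds_in A {x, y}. z \<le> w)"

definition pseudo_join_semilattice :: "'a::order set \<Rightarrow> bool" where
  "pseudo_join_semilattice A \<longleftrightarrow> A \<noteq> {} \<and>
    (\<forall>Y \<subseteq> A. Y = {} \<or> card Y = 2 \<longrightarrow>
      (\<exists>G \<subseteq> A. finite G \<and> upper_bounds_in A Y = {p \<in> A. \<exists>g \<in> G. g \<le> p}))"

definition supported :: "'a::order set \<Rightarrow> bool" where
  "supported A \<longleftrightarrow> pseudo_join_semilattice A \<and>
    (\<forall>F \<subseteq> A. finite F \<longrightarrow>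
      (\<exists>Z \<subseteq> A. finite Z \<and> F \<subseteq> Z \<and> (\<forall>Y \<subseteq> Z. finite Y \<longrightarrow> nabla A Y \<subseteq> Z)))"

definition almost_join_semilattice :: "'a::order set \<Rightarrow> bool" where
  "almost_join_semilattice A \<longleftrightarrow> pseudo_join_semilattice A \<and>
    (\<forall>a \<in> A. join_semilattice {x \<in> A. x \<le> a})"

definition with_zero :: "'a::order set \<Rightarrow> bool" where
  "with_zero A \<longleftrightarrow> (\<exists>z \<in> A. \<forall>x \<in> A. z \<le> x)"

definition disjoint_union_of :: "'a::order set \<Rightarrow> 'a set set \<Rightarrow> bool" where
  "disjoint_union_of A C \<longleftrightarrow> A = \<Union>C \<and>
    (\<forall>B \<in> C. \<forall>D \<in> C. B \<noteq> D \<longrightarrow> (\<forall>x \<in> B. \<forall>y \<in> D. \<not> x \<le> y \<and> \<not> y \<le> x))"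

definition poset_ideal :: "'a::order set \<Rightarrow> bool" where
  "poset_ideal u \<longleftrightarrow> u \<noteq> {} \<and>
    (\<forall>x \<in> u. \<forall>y \<in> u. \<exists>z \<in> u. x \<le> z \<and> y \<le> z) \<and>
    (\<forall>x \<in> u. \<forall>y. y \<le> x \<longrightarrow> y \<in> u)"

definition norm_covering :: "('x::order \<Rightarrow> 'p::order) \<Rightarrow> bool" where
  "norm_covering \<delta> \<longleftrightarrow> pseudo_join_semilattice (UNIV :: 'x set) \<and> mono \<delta>"

definition sharp_ideal :: "('x::order \<Rightarrow> 'p::order) \<Rightarrow> 'x set \<Rightarrow> bool" where
  "sharp_ideal \<delta> u \<longleftrightarrow> poset_ideal u \<and> (\<exists>p \<in> \<delta> ` u. \<forall>q \<in> \<delta> ` u. q \<le> p)"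

definition ideal_norm :: "('x::order \<Rightarrow> 'p::order) \<Rightarrow> 'x set \<Rightarrow> 'p" where
  "ideal_norm \<delta> u = (GREATEST p. p \<in> \<delta> ` u)"

definition nonmax_ideals :: "('x::order \<Rightarrow> 'p::order) \<Rightarrow> 'x set set \<Rightarrow> 'x set set" where
  "nonmax_ideals \<delta> XX = {u \<in> XX. ideal_norm \<delta> u \<notin> maximal_elems UNIV}"

definition isotone_section ::
    "('x::order \<Rightarrow> 'p::order) \<Rightarrow> 'x set set \<Rightarrow> ('p \<Rightarrow> 'x set) \<Rightarrow> bool" where
  "isotone_section \<delta> XX \<sigma> \<longleftrightarrow>
    \<sigma> \<in> UNIV \<rightarrow> XX \<and> mono \<sigma> \<and> (\<forall>p. ideal_norm \<delta> (\<sigma> p) = p)"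

definition lifter :: "'l rel \<Rightarrow> ('x::order \<Rightarrow> 'p::order) \<Rightarrow> 'x set set \<Rightarrow> bool" where
  "lifter r \<delta> XX \<longleftrightarrow>
    norm_covering \<delta> \<and>
    (\<forall>u \<in> XX. sharp_ideal \<delta> u) \<and>
    (\<forall>u \<in> nonmax_ideals \<delta> XX. |{v \<in> XX. v \<subseteq> u}| <o cofinality r) \<and>
    (\<forall>S \<in> nonmax_ideals \<delta> XX \<rightarrow> small_subsets r UNIV.
      \<exists>\<sigma>. isotone_section \<delta> XX \<sigma> \<and> (\<forall>a b. a < b \<longrightarrow> S (\<sigma> a) \<inter> \<sigma> b \<subseteq> \<sigma> a)) \<and>
    (r =o natLeq \<longrightarrow> supported (UNIV :: 'x set))"

end

theory Submission
  imports Defs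
begin

text \<open>
  Fix for every ideal in the lifter an element whose norm is the norm of the ideal. If \<open>\<sigma>\<close> is an
  isotone section and \<open>\<sigma> p\<close> contains two elements of \<open>X\<close>, then it contains one of the finitely many
  generators of their upper bounds; so finite generation of upper bounds descends from \<open>X\<close> to \<open>P\<close>.
  The remaining claims say that certain elements of \<open>\<sigma> b\<close> (such a generator, or the chosen element
  of an ideal \<open>\<sigma> c\<close> in the range of \<open>f\<close>) already lie in \<open>\<sigma> a\<close>, where \<open>a < b\<close>. It suffices to let
  \<open>S (\<sigma> a)\<close> contain them, and since the ideals \<open>\<sigma> c\<close> with \<open>c \<le> a\<close> are among the fewer than
  \<open>cf \<lambda>\<close> many ideals below \<open>\<sigma> a\<close>, this can be done with \<open>S (\<sigma> a)\<close> depending on the ideal \<open>\<sigma> a\<close>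
  only.
\<close>

section \<open>Cardinal arithmetic\<close>

lemma cofinality_ordLeq:
  assumes "Cinfinite r"
  shows "cofinality r \<le>o r"
proof -
  have "cofinal (Field r) r"
    using assms infinite_Card_order_limit[of r]
    unfolding cofinal_def cinfinite_def by blast
  with cofinality_props(2)[OF assms subset_refl] have "cofinality r \<le>o |Field r|" .
  then show ?thesis
    using assms card_of_Field_ordIso ordLeq_ordIso_trans by blast
qed

lemma finite_ordLess_Cinfinite:
  assumes "Cinfinite r" and "finite A"
  shows "|A| <o r"
proof (rule finite_ordLess_infinite[OF card_of_Well_order])
  show "Well_order r"
    using assms(1) card_order_on_well_order_on by blast
  show "finite (Field |A| )" "infinite (Field r)"
    using assms unfolding cinfinite_def Field_card_of by auto
qed

text \<open>For infinite \<open>A\<close> the index set \<open>A \<times> A\<close> has the size of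
  \<open>A\<close>, and finite pieces do not raise it; for finite \<open>A\<close> the union is
  finite. This bounds the set of generators attached to pairs of ideals below a fixed one.\<close>

lemma ordLess_finite_UN_pairs:
  assumes "Cinfinite r" and "|A| <o r" and "\<And>a b. a \<in> A \<Longrightarrow> b \<in> A \<Longrightarrow> finite (B a b)"
  shows "|\<Union>(a, b) \<in> A \<times> A. B a b| <o r"
proof (cases "finite A")
  case True
  then have "finite (\<Union>(a, b) \<in> A \<times> A. B a b)"
    using assms(3) by auto
  then show ?thesis
    using finite_ordLess_Cinfinite assms(1) by blast
next
  case False
  then have "|A \<times> A| \<le>o |A|"
    using card_of_Times_same_infinite ordIso_imp_ordLeq by blast
  moreover have "Cinfinite |A|"
    using False card_of_Card_order unfolding cinfinite_def Field_card_of by blast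
  then have "\<forall>c \<in> A \<times> A. |case c of (a, b) \<Rightarrow> B a b| \<le>o |A|"
    using assms(3) by (auto intro!: ordLess_imp_ordLeq finite_ordLess_Cinfinite)
  ultimately have "|\<Union>(a, b) \<in> A \<times> A. B a b| \<le>o |A|"
    by (intro card_of_UNION_ordLeq_infinite False)
  then show ?thesis
    using assms(2) ordLeq_ordLess_trans by blast
qed

section \<open>Norms of sharp ideals and isotone sections\<close>

lemma sharp_ideal_norm:
  assumes "sharp_ideal \<delta> u"
  shows "ideal_norm \<delta> u \<in> \<delta> ` u" and "x \<in> u \<Longrightarrow> \<delta> x \<le> ideal_norm \<delta> u"
proof -
  obtain p where p: "p \<in> \<delta> ` u" "\<forall>q \<in> \<delta> ` u. q \<le> p"
    using assms unfolding sharp_ideal_def by blast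
  then have "ideal_norm \<delta> u = p"
    unfolding ideal_norm_def by (intro Greatest_equality) auto
  with p show "ideal_norm \<delta> u \<in> \<delta> ` u" and "x \<in> u \<Longrightarrow> \<delta> x \<le> ideal_norm \<delta> u"
    by auto
qed

locale lifter_of_poset =
  fixes r :: "'l rel"
    and \<delta> :: "'x::order \<Rightarrow> 'p::order"
    and XX :: "'x set set"
  assumes Cinfinite: "Cinfinite r"
    and lifter: "lifter r \<delta> XX"
begin

lemma norm_mono: "x \<le> y \<Longrightarrow> \<delta> x \<le> \<delta> y"
  using lifter unfolding lifter_def norm_covering_def mono_def by blast

lemma pseudo_join_semilattice_cover: "pseudo_join_semilattice (UNIV :: 'x set)"
  using lifter unfolding lifter_def norm_covering_def by blast

lemma sharp: "u \<in> XX \<Longrightarrow> sharp_ideal \<delta> u"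
  using lifter unfolding lifter_def by blast

lemma ideal: "u \<in> XX \<Longrightarrow> poset_ideal u"
  using sharp unfolding sharp_ideal_def by blast

lemma card_below:
  "u \<in> nonmax_ideals \<delta> XX \<Longrightarrow> |{v \<in> XX. v \<subseteq> u}| <o cofinality r"
  using lifter unfolding lifter_def by blast

lemma obtain_section:
  assumes "\<And>u. u \<in> nonmax_ideals \<delta> XX \<Longrightarrow> |S u| <o r"
  obtains \<sigma> where "isotone_section \<delta> XX \<sigma>" "\<And>a b. a < b \<Longrightarrow> S (\<sigma> a) \<inter> \<sigma> b \<subseteq> \<sigma> a"
proof -
  have "S \<in> nonmax_ideals \<delta> XX \<rightarrow> small_subsets r UNIV"
    using assms unfolding small_subsets_def by auto
  then have "\<exists>\<sigma>. isotone_section \<delta> XX \<sigma> \<and> (\<forall>a b. a < b \<longrightarrow> S (\<sigma> a) \<inter> \<sigma> b \<subseteq> \<sigma> a)"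
    using lifter unfolding lifter_def by blast
  then show thesis
    using that by blast
qed

text \<open>Meaningful for sharp ideals only, where the norm is attained. Peaks let a statement
  about ideals be tested on single elements of the covering.\<close>

definition peak :: "'x set \<Rightarrow> 'x" where
  "peak u = (SOME x. x \<in> u \<and> \<delta> x = ideal_norm \<delta> u)"

lemma peak:
  assumes "u \<in> XX"
  shows "peak u \<in> u" and "\<delta> (peak u) = ideal_norm \<delta> u"
proof -
  have "\<exists>x. x \<in> u \<and> \<delta> x = ideal_norm \<delta> u"
    using sharp_ideal_norm(1)[OF sharp[OF assms]] by auto
  from someI_ex[OF this] show "peak u \<in> u" and "\<delta> (peak u) = ideal_norm \<delta> u"
    unfolding peak_def by auto
qed

context
  fixes \<sigma> :: "'p \<Rightarrow> 'x set"
  assumes isotone_section: "isotone_section \<delta> XX \<sigma>"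
begin

lemma section_in: "\<sigma> p \<in> XX"
  using isotone_section unfolding isotone_section_def by auto

lemma section_mono: "p \<le> q \<Longrightarrow> \<sigma> p \<subseteq> \<sigma> q"
  using isotone_section unfolding isotone_section_def by (auto dest: monoD)

lemma norm_section: "ideal_norm \<delta> (\<sigma> p) = p"
  using isotone_section unfolding isotone_section_def by auto

lemma section_norm_le: "x \<in> \<sigma> p \<Longrightarrow> \<delta> x \<le> p"
  using sharp_ideal_norm(2)[OF sharp[OF section_in]] norm_section by metis

lemma section_lower: "x \<in> \<sigma> p \<Longrightarrow> y \<le> x \<Longrightarrow> y \<in> \<sigma> p"
  using ideal[OF section_in] unfolding poset_ideal_def by blast

lemma section_peak: "peak (\<sigma> p) \<in> \<sigma> p" and norm_peak_section: "\<delta> (peak (\<sigma> p)) = p"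
  using peak[OF section_in] norm_section by auto

lemma inj_section: "inj \<sigma>"
  using norm_section by (metis injI)

lemma section_nonmax: "a < b \<Longrightarrow> \<sigma> a \<in> nonmax_ideals \<delta> XX"
  unfolding nonmax_ideals_def maximal_elems_def using section_in norm_section by auto

lemma section_meets_generators:
  assumes "(UNIV :: 'x set) = {p. \<exists>g \<in> G. g \<le> p}"
  shows "\<exists>g \<in> G. g \<in> \<sigma> p"
proof -
  obtain g where "g \<in> G" "g \<le> peak (\<sigma> p)"
    using assms by blast
  then show ?thesis
    using section_peak section_lower by blast
qed

text \<open>Directedness gives an upper bound of \<open>x\<close> and \<open>y\<close> inside
  \<open>\<sigma> p\<close>; a generator lies below it, and the ideal is a lower set.\<close>

lemma section_meets_pair_generators:
  assumes "upper_bounds_in UNIV {x, y} = {p. \<exists>g \<in> G. g \<le> p}" and "x \<in> \<sigma> p" and "y \<in> \<sigma> p"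
  shows "\<exists>g \<in> G. g \<in> \<sigma> p"
proof -
  obtain z where "z \<in> \<sigma> p" "x \<le> z" "y \<le> z"
    using ideal[OF section_in] assms(2,3) unfolding poset_ideal_def by blast
  moreover from this obtain g where "g \<in> G" "g \<le> z"
    using assms(1) unfolding upper_bounds_in_def by blast
  ultimately show ?thesis
    using section_lower by blast
qed

end

lemma ex_section: "\<exists>\<sigma>. isotone_section \<delta> XX \<sigma>"
  using obtain_section[of "\<lambda>_. {}"] finite_ordLess_Cinfinite[OF Cinfinite finite.emptyI] by metis

lemma ex_generators: "\<exists>G :: 'x set. finite G \<and> UNIV = {p. \<exists>g \<in> G. g \<le> p}"
  using pseudo_join_semilattice_cover
  unfolding pseudo_join_semilattice_def upper_bounds_in_def by auto

text \<open>The definition speaks of two-element sets only; in the degenerate case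
  \<open>x = y\<close> the singleton generates.\<close>

lemma ex_pair_generators:
  fixes x y :: 'x
  shows "\<exists>G. finite G \<and> upper_bounds_in UNIV {x, y} = {p. \<exists>g \<in> G. g \<le> p}"
proof (cases "x = y")
  case True
  then have "finite {x} \<and> upper_bounds_in UNIV {x, y} = {p. \<exists>g \<in> {x}. g \<le> p}"
    unfolding upper_bounds_in_def by auto
  then show ?thesis ..
next
  case False
  then have "card {x, y} = 2"
    by simp
  then show ?thesis
    using pseudo_join_semilattice_cover unfolding pseudo_join_semilattice_def by fastforce
qed

section \<open>Smallness below nonmaximal elements\<close>

text \<open>Any isotone section embeds the elements below \<open>a\<close> into the ideals contained
  in \<open>\<sigma> a\<close>, of which there are few.\<close>

lemma lower_small_nonmaximal: "lower_small (cofinality r) (UNIV - maximal_elems UNIV :: 'p set)"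
  unfolding lower_small_def
proof
  fix a :: 'p
  assume a: "a \<in> UNIV - maximal_elems UNIV"
  obtain \<sigma> where \<sigma>: "isotone_section \<delta> XX \<sigma>"
    using ex_section by blast
  let ?A = "{x \<in> UNIV - maximal_elems UNIV. x \<le> a}"
  have "\<sigma> ` ?A \<subseteq> {v \<in> XX. v \<subseteq> \<sigma> a}"
    using section_in[OF \<sigma>] section_mono[OF \<sigma>] by blast
  moreover have "inj_on \<sigma> ?A"
    using inj_section[OF \<sigma>] by (rule inj_on_subset) simp
  ultimately have "|?A| \<le>o |{v \<in> XX. v \<subseteq> \<sigma> a}|"
    using iffD1[OF card_of_ordLeq] by blast
  moreover have "\<sigma> a \<in> nonmax_ideals \<delta> XX"
    using a unfolding nonmax_ideals_def by (simp add: section_in[OF \<sigma>] norm_section[OF \<sigma>])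
  ultimately show "|?A| <o cofinality r"
    using card_below ordLeq_ordLess_trans by blast
qed

section \<open>Finite generation of upper bounds in the base poset\<close>

lemma ex_generators_base: "\<exists>F :: 'p set. finite F \<and> UNIV = {p. \<exists>g \<in> F. g \<le> p}"
proof -
  obtain \<sigma> where \<sigma>: "isotone_section \<delta> XX \<sigma>"
    using ex_section by blast
  obtain G :: "'x set" where G: "finite G" "UNIV = {p. \<exists>g \<in> G. g \<le> p}"
    using ex_generators by blast
  have "\<exists>g \<in> \<delta> ` G. g \<le> p" for p
    using section_meets_generators[OF \<sigma> G(2)] section_norm_le[OF \<sigma>] by blast
  then show ?thesis
    using G(1) by (intro exI[of _ "\<delta> ` G"]) auto
qed

text \<open>The norms of generators for the two peaks work: if \<open>p\<close> bounds
  \<open>a\<close> and \<open>b\<close>, then \<open>\<sigma> p\<close> contains both peaks, hence a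
  generator, whose norm is at most \<open>p\<close>. Conversely, isotonicity of the norm puts
  \<open>a\<close> and \<open>b\<close> below the norm of each generator.\<close>

lemma ex_pair_generators_base:
  fixes a b :: 'p
  shows "\<exists>F. finite F \<and> upper_bounds_in UNIV {a, b} = {p. \<exists>g \<in> F. g \<le> p}"
proof -
  obtain \<sigma> where \<sigma>: "isotone_section \<delta> XX \<sigma>"
    using ex_section by blast
  let ?x = "peak (\<sigma> a)" and ?y = "peak (\<sigma> b)"
  obtain G where G: "finite G" "upper_bounds_in UNIV {?x, ?y} = {p. \<exists>g \<in> G. g \<le> p}"
    using ex_pair_generators by blast
  have "upper_bounds_in UNIV {a, b} = {p. \<exists>g \<in> \<delta> ` G. g \<le> p}"
  proof (intro subset_antisym subsetI)
    fix p
    assume "p \<in> upper_bounds_in UNIV {a, b}"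
    then have "?x \<in> \<sigma> p" "?y \<in> \<sigma> p"
      using section_peak[OF \<sigma>] section_mono[OF \<sigma>] unfolding upper_bounds_in_def by blast+
    then show "p \<in> {p. \<exists>g \<in> \<delta> ` G. g \<le> p}"
      using section_meets_pair_generators[OF \<sigma> G(2)] section_norm_le[OF \<sigma>] by blast
  next
    fix p
    assume "p \<in> {p. \<exists>g \<in> \<delta> ` G. g \<le> p}"
    then obtain g where g: "g \<in> G" "\<delta> g \<le> p"
      by blast
    then have "?x \<le> g" "?y \<le> g"
      using G(2) unfolding upper_bounds_in_def by blast+
    then have "a \<le> \<delta> g" "b \<le> \<delta> g"
      using norm_mono norm_peak_section[OF \<sigma>] by metis+
    then show "p \<in> upper_bounds_in UNIV {a, b}"
      using g(2) unfolding upper_bounds_in_def by auto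
  qed
  then show ?thesis
    using G(1) by blast
qed

lemma pseudo_join_semilattice_base: "pseudo_join_semilattice (UNIV :: 'p set)"
  unfolding pseudo_join_semilattice_def
proof (intro conjI allI impI)
  fix Y :: "'p set"
  assume "Y = {} \<or> card Y = 2"
  then consider "Y = {}" | a b where "Y = {a, b}"
    by (auto simp: card_2_iff)
  then show "\<exists>G \<subseteq> UNIV. finite G \<and> upper_bounds_in UNIV Y = {p \<in> UNIV. \<exists>g \<in> G. g \<le> p}"
  proof cases
    case 1
    then show ?thesis
      using ex_generators_base unfolding upper_bounds_in_def by simp
  next
    case 2
    then show ?thesis
      using ex_pair_generators_base by simp
  qed
qed simp

section \<open>Joins below an element\<close>

text \<open>The bound \<open>l\<close> is the norm of a generator for the peaks of
  \<open>\<sigma> p\<close> and \<open>\<sigma> q\<close>. One such generator lies in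
  \<open>\<sigma> n\<close>, hence in \<open>\<sigma> a\<close>, and the condition on
  \<open>S\<close> for \<open>m < a\<close> pulls it into \<open>\<sigma> m\<close>.\<close>

lemma common_lower_upper_bound:
  fixes a p q m n :: 'p
  assumes "m \<le> a" "n \<le> a"
    and "m \<in> upper_bounds_in UNIV {p, q}" "n \<in> upper_bounds_in UNIV {p, q}"
  shows "\<exists>l \<in> upper_bounds_in UNIV {p, q}. l \<le> m \<and> l \<le> n"
proof (cases "m = a")
  case True
  then show ?thesis
    using assms by blast
next
  case False
  then have "m < a"
    using assms(1) by simp
  obtain G :: "'x \<Rightarrow> 'x \<Rightarrow> 'x set" where G: "\<And>x y. finite (G x y)"
    "\<And>x y. upper_bounds_in UNIV {x, y} = {p. \<exists>g \<in> G x y. g \<le> p}"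
    using ex_pair_generators by metis
  \<comment> \<open>The section is obtained only after \<open>S\<close> is fixed, so
    \<open>S u\<close> collects generators for all pairs of ideals below \<open>u\<close>; for
    \<open>u = \<sigma> m\<close> these include \<open>\<sigma> p\<close> and
    \<open>\<sigma> q\<close>.\<close>
  define S where "S u = (\<Union>(v, w) \<in> {v \<in> XX. v \<subseteq> u} \<times> {v \<in> XX. v \<subseteq> u}. G (peak v) (peak w))" for u
  have "|S u| <o r" if "u \<in> nonmax_ideals \<delta> XX" for u
    unfolding S_def
    using card_below[OF that] cofinality_ordLeq[OF Cinfinite] G(1)
    by (intro ordLess_finite_UN_pairs Cinfinite) (auto intro: ordLess_ordLeq_trans)
  then obtain \<sigma> where \<sigma>: "isotone_section \<delta> XX \<sigma>" "\<And>a b. a < b \<Longrightarrow> S (\<sigma> a) \<inter> \<sigma> b \<subseteq> \<sigma> a"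
    using obtain_section by blast
  let ?x = "peak (\<sigma> p)" and ?y = "peak (\<sigma> q)"
  have "?x \<in> \<sigma> n" "?y \<in> \<sigma> n"
    using assms(4) section_peak[OF \<sigma>(1)] section_mono[OF \<sigma>(1)]
    unfolding upper_bounds_in_def by blast+
  then obtain g where g: "g \<in> G ?x ?y" "g \<in> \<sigma> n"
    using section_meets_pair_generators[OF \<sigma>(1) G(2)] by blast
  have "\<sigma> p \<subseteq> \<sigma> m" "\<sigma> q \<subseteq> \<sigma> m"
    using assms(3) section_mono[OF \<sigma>(1)] unfolding upper_bounds_in_def by blast+
  then have "g \<in> S (\<sigma> m)"
    using g(1) section_in[OF \<sigma>(1)] unfolding S_def by blast
  moreover have "g \<in> \<sigma> a"
    using g(2) section_mono[OF \<sigma>(1) assms(2)] by blast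
  ultimately have "g \<in> \<sigma> m"
    using \<sigma>(2)[OF \<open>m < a\<close>] by blast
  then have "\<delta> g \<le> m" "\<delta> g \<le> n"
    using g(2) section_norm_le[OF \<sigma>(1)] by blast+
  moreover have "?x \<le> g" "?y \<le> g"
    using G(2) g(1) unfolding upper_bounds_in_def by blast+
  then have "p \<le> \<delta> g" "q \<le> \<delta> g"
    using norm_mono norm_peak_section[OF \<sigma>(1)] by metis+
  ultimately show ?thesis
    unfolding upper_bounds_in_def by auto
qed

text \<open>The join is a minimal element among the finitely many generators below
  \<open>a\<close>.\<close>

lemma join_semilattice_below: "join_semilattice {x :: 'p. x \<le> a}"
  unfolding join_semilattice_def
proof (intro conjI ballI)
  fix p q :: 'p
  assume "p \<in> {x. x \<le> a}" "q \<in> {x. x \<le> a}"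
  then have a: "a \<in> upper_bounds_in UNIV {p, q}"
    unfolding upper_bounds_in_def by auto
  obtain F where F: "finite F" "upper_bounds_in UNIV {p, q} = {p. \<exists>g \<in> F. g \<le> p}"
    using ex_pair_generators_base by blast
  then have "finite {g \<in> F. g \<le> a}" "{g \<in> F. g \<le> a} \<noteq> {}"
    using a by auto
  then obtain z where z: "z \<in> F" "z \<le> a" and min: "\<And>g. g \<in> F \<Longrightarrow> g \<le> a \<Longrightarrow> g \<le> z \<Longrightarrow> g = z"
    using finite_has_minimal[of "{g \<in> F. g \<le> a}"] by blast
  have ub: "z \<in> upper_bounds_in UNIV {p, q}"
    using F(2) z(1) by blast
  have "z \<le> w" if w: "w \<in> upper_bounds_in {x. x \<le> a} {p, q}" for w
  proof -
    have "w \<le> a" "w \<in> upper_bounds_in UNIV {p, q}"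
      using w unfolding upper_bounds_in_def by auto
    \<comment> \<open>A generator below \<open>l\<close> is also below \<open>z\<close>, so
      minimality makes it \<open>z\<close> itself, whence \<open>z \<le> l \<le> w\<close>.\<close>
    then obtain l where l: "l \<in> upper_bounds_in UNIV {p, q}" "l \<le> z" "l \<le> w"
      using common_lower_upper_bound[OF z(2)] ub by blast
    then obtain g where "g \<in> F" "g \<le> l"
      using F(2) by blast
    then have "g = z"
      using min l(2) z(2) by (meson order_trans)
    then show "z \<le> w"
      using \<open>g \<le> l\<close> l(3) by simp
  qed
  then show "\<exists>z \<in> upper_bounds_in {x. x \<le> a} {p, q}.
      \<forall>w \<in> upper_bounds_in {x. x \<le> a} {p, q}. z \<le> w"
    using ub z(2) unfolding upper_bounds_in_def by (intro bexI[of _ z]) auto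
qed auto

lemma almost_join_semilattice_base: "almost_join_semilattice (UNIV :: 'p set)"
  unfolding almost_join_semilattice_def
  using pseudo_join_semilattice_base join_semilattice_below by simp

section \<open>Decomposition into finitely many posets with zero\<close>

text \<open>Here \<open>S\<close> is constant, equal to a finite generating set \<open>G\<close> of
  the covering. A generator in \<open>\<sigma> n\<close> lies in \<open>\<sigma> p\<close>, hence in
  \<open>\<sigma> m\<close> when \<open>m < p\<close>; its norm is below both minimal elements and
  so equals both.\<close>

lemma minimal_elems_below_eq:
  fixes m n p :: 'p
  assumes "m \<in> minimal_elems UNIV" "n \<in> minimal_elems UNIV" "m \<le> p" "n \<le> p"
  shows "m = n"
proof (cases "m = p")
  case True
  then show ?thesis
    using assms unfolding minimal_elems_def by (auto simp: order_le_less)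
next
  case False
  then have "m < p"
    using assms(3) by simp
  obtain G :: "'x set" where G: "finite G" "UNIV = {p. \<exists>g \<in> G. g \<le> p}"
    using ex_generators by blast
  obtain \<sigma> where \<sigma>: "isotone_section \<delta> XX \<sigma>" "\<And>a b. a < b \<Longrightarrow> G \<inter> \<sigma> b \<subseteq> \<sigma> a"
    using obtain_section[of "\<lambda>_. G"] finite_ordLess_Cinfinite[OF Cinfinite G(1)] by metis
  obtain g where g: "g \<in> G" "g \<in> \<sigma> n"
    using section_meets_generators[OF \<sigma>(1) G(2)] by blast
  then have "g \<in> \<sigma> m"
    using \<sigma>(2)[OF \<open>m < p\<close>] section_mono[OF \<sigma>(1) assms(4)] by blast
  then have "\<delta> g \<le> m" "\<delta> g \<le> n"
    using g(2) section_norm_le[OF \<sigma>(1)] by blast+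
  then show ?thesis
    using assms(1,2) unfolding minimal_elems_def by (auto simp: order_le_less)
qed

text \<open>The components are the principal up-sets of the minimal elements. Comparable elements of
  two components would put two distinct minimal elements below a single one.\<close>

lemma disjoint_union_with_zero:
  "\<exists>C. finite C \<and> (\<forall>B \<in> C. with_zero B) \<and> disjoint_union_of (UNIV :: 'p set) C"
proof -
  obtain F :: "'p set" where F: "finite F" "UNIV = {p. \<exists>g \<in> F. g \<le> p}"
    using ex_generators_base by blast
  let ?M = "minimal_elems UNIV :: 'p set"
  have "?M \<subseteq> F"
  proof
    fix m
    assume "m \<in> ?M"
    moreover obtain g where "g \<in> F" "g \<le> m"
      using F(2) by blast
    ultimately show "m \<in> F"
      unfolding minimal_elems_def by (auto simp: order_le_less)
  qed
  then have "finite ?M"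
    using F(1) finite_subset by blast
  have cover: "\<exists>m \<in> ?M. m \<le> p" for p
  proof -
    obtain f where "f \<in> F" "f \<le> p"
      using F(2) by blast
    \<comment> \<open>An element minimal in \<open>F\<close> is minimal in the whole poset, because
      every element has a member of \<open>F\<close> below it.\<close>
    then obtain m where m: "m \<in> F" "m \<le> f" "\<And>g. g \<in> F \<Longrightarrow> g \<le> m \<Longrightarrow> g = m"
      using finite_has_minimal2[OF F(1)] by metis
    have "\<not> y < m" for y
    proof
      assume "y < m"
      obtain g where "g \<in> F" "g \<le> y"
        using F(2) by blast
      then show False
        using m(3)[of g] \<open>y < m\<close> by (metis leD less_imp_le order_trans)
    qed
    then have "m \<in> ?M"
      unfolding minimal_elems_def by simp
    then show ?thesis
      using m(2) \<open>f \<le> p\<close> order_trans by blast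
  qed
  let ?C = "atLeast ` ?M"
  have "disjoint_union_of UNIV ?C"
    unfolding disjoint_union_of_def
  proof (intro conjI ballI impI)
    show "UNIV = \<Union>?C"
      using cover by auto
  next
    fix B D x y
    assume "B \<in> ?C" "D \<in> ?C" "B \<noteq> D" "x \<in> B" "y \<in> D"
    then obtain m n where mn: "m \<in> ?M" "n \<in> ?M" "m \<noteq> n" "m \<le> x" "n \<le> y"
      by auto
    then show "\<not> x \<le> y" and "\<not> y \<le> x"
      using minimal_elems_below_eq by (meson order_trans)+
  qed
  moreover have "\<forall>B \<in> ?C. with_zero B"
    unfolding with_zero_def by auto
  ultimately show ?thesis
    using \<open>finite ?M\<close> by blast
qed

section \<open>Free sections and free injections\<close>

lemma free_section:
  assumes f: "f \<in> small_subsets (cofinality r) (nonmax_ideals \<delta> XX) \<rightarrow> small_subsets r XX"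
    and mono: "mono_on (small_subsets (cofinality r) (nonmax_ideals \<delta> XX)) f"
  shows "\<exists>\<sigma>. isotone_section \<delta> XX \<sigma> \<and>
    (\<forall>a b. a < b \<longrightarrow> f (\<sigma> ` {..a}) \<inter> \<sigma> ` {..b} \<subseteq> \<sigma> ` {..a})"
proof -
  define D where "D u = {v \<in> nonmax_ideals \<delta> XX. v \<subseteq> u}" for u
  have D: "D u \<in> small_subsets (cofinality r) (nonmax_ideals \<delta> XX)"
    if "u \<in> nonmax_ideals \<delta> XX" for u
  proof -
    have "D u \<subseteq> {v \<in> XX. v \<subseteq> u}"
      unfolding D_def nonmax_ideals_def by auto
    then have "|D u| <o cofinality r"
      using card_below[OF that] card_of_mono1 ordLeq_ordLess_trans by blast
    then show ?thesis
      unfolding small_subsets_def D_def by auto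
  qed
  have "|peak ` f (D u)| <o r" if "u \<in> nonmax_ideals \<delta> XX" for u
    using funcset_mem[OF f D[OF that]] card_of_image ordLeq_ordLess_trans
    unfolding small_subsets_def by blast
  then obtain \<sigma> where \<sigma>: "isotone_section \<delta> XX \<sigma>"
    "\<And>a b. a < b \<Longrightarrow> peak ` f (D (\<sigma> a)) \<inter> \<sigma> b \<subseteq> \<sigma> a"
    using obtain_section[of "\<lambda>u. peak ` f (D u)"] by blast
  have "f (\<sigma> ` {..a}) \<inter> \<sigma> ` {..b} \<subseteq> \<sigma> ` {..a}" if "a < b" for a b
  proof
    fix v
    assume v: "v \<in> f (\<sigma> ` {..a}) \<inter> \<sigma> ` {..b}"
    then obtain c where c: "v = \<sigma> c" "c \<le> b"
      by auto
    have sub: "\<sigma> ` {..a} \<subseteq> D (\<sigma> a)"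
    proof
      fix u
      assume "u \<in> \<sigma> ` {..a}"
      then obtain c where c: "u = \<sigma> c" "c \<le> a"
        by auto
      \<comment> \<open>The element \<open>b\<close> witnesses that \<open>c\<close> is not maximal,
        as membership in \<open>D\<close> requires.\<close>
      with that have "c < b"
        by simp
      then show "u \<in> D (\<sigma> a)"
        using section_nonmax[OF \<sigma>(1)] section_mono[OF \<sigma>(1)] c unfolding D_def by blast
    qed
    have Da: "D (\<sigma> a) \<in> small_subsets (cofinality r) (nonmax_ideals \<delta> XX)"
      using D section_nonmax[OF \<sigma>(1) that] .
    then have "\<sigma> ` {..a} \<in> small_subsets (cofinality r) (nonmax_ideals \<delta> XX)"
      using sub card_of_mono1[OF sub] ordLeq_ordLess_trans
      unfolding small_subsets_def by blast
    then have "f (\<sigma> ` {..a}) \<subseteq> f (D (\<sigma> a))"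
      using mono_onD[OF mono _ Da sub] by blast
    then have "peak v \<in> peak ` f (D (\<sigma> a))"
      using v by blast
    moreover have "peak v \<in> \<sigma> b"
      using section_peak[OF \<sigma>(1)] section_mono[OF \<sigma>(1) c(2)] c(1) by blast
    ultimately have "peak v \<in> \<sigma> a"
      using \<sigma>(2)[OF that] by blast
    \<comment> \<open>The peak of \<open>\<sigma> c\<close> has norm \<open>c\<close>, while members
      of \<open>\<sigma> a\<close> have norm at most \<open>a\<close>.\<close>
    then have "c \<le> a"
      using section_norm_le[OF \<sigma>(1)] norm_peak_section[OF \<sigma>(1)] c(1) by metis
    then show "v \<in> \<sigma> ` {..a}"
      using c(1) by simp
  qed
  then show ?thesis
    using \<sigma>(1) by blast
qed

text \<open>The claim is carried over from \<open>free_section\<close> along a bijection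
  \<open>h\<close> from \<open>XX\<close> to the field of \<open>\<kappa>\<close>. Injectivity of
  \<open>h \<circ> \<sigma>\<close> comes from the norm being a left inverse of
  \<open>\<sigma>\<close>.\<close>

lemma free_injection:
  fixes \<kappa> :: "'k rel"
  assumes "Card_order \<kappa>" and "\<kappa> =o |XX|"
    and f: "f \<in> small_subsets (cofinality r) (Field \<kappa>) \<rightarrow> small_subsets r (Field \<kappa>)"
    and mono: "mono_on (small_subsets (cofinality r) (Field \<kappa>)) f"
  shows "\<exists>\<tau> :: 'p \<Rightarrow> 'k. \<tau> \<in> UNIV \<rightarrow> Field \<kappa> \<and> inj \<tau> \<and>
    (\<forall>a b. a < b \<longrightarrow> f (\<tau> ` {..a}) \<inter> \<tau> ` {..b} \<subseteq> \<tau> ` {..a})"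
proof -
  have "|XX| =o |Field \<kappa>|"
    using assms(1,2) card_of_Field_ordIso ordIso_symmetric ordIso_transitive by blast
  then obtain h where h: "bij_betw h XX (Field \<kappa>)"
    using card_of_ordIso by blast
  let ?k = "inv_into XX h"
  have k: "bij_betw ?k (Field \<kappa>) XX"
    using h bij_betw_inv_into by blast
  \<comment> \<open>The conjugate of \<open>f\<close> under \<open>h\<close>;
    \<open>free_section\<close> only needs it on sets of nonmaximal ideals.\<close>
  define f' where "f' W = ?k ` f (h ` W)" for W
  have image: "h ` W \<in> small_subsets (cofinality r) (Field \<kappa>)"
    if "W \<in> small_subsets (cofinality r) (nonmax_ideals \<delta> XX)" for W
  proof -
    have "W \<subseteq> XX" "|h ` W| <o cofinality r"
      using that card_of_image ordLeq_ordLess_trans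
      unfolding small_subsets_def nonmax_ideals_def by blast+
    then show ?thesis
      using bij_betw_imp_surj_on[OF h] unfolding small_subsets_def by blast
  qed
  have "f' W \<in> small_subsets r XX"
    if "W \<in> small_subsets (cofinality r) (nonmax_ideals \<delta> XX)" for W
  proof -
    have "f (h ` W) \<subseteq> Field \<kappa>" "|f (h ` W)| <o r"
      using funcset_mem[OF f image[OF that]] unfolding small_subsets_def by blast+
    then have "?k ` f (h ` W) \<subseteq> XX"
      using image_mono[of "f (h ` W)" "Field \<kappa>" ?k] bij_betw_imp_surj_on[OF k] by simp
    moreover have "|?k ` f (h ` W)| <o r"
      using ordLeq_ordLess_trans[OF card_of_image \<open>|f (h ` W)| <o r\<close>] .
    ultimately show ?thesis
      unfolding small_subsets_def f'_def by blast
  qed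
  then have "f' \<in> small_subsets (cofinality r) (nonmax_ideals \<delta> XX) \<rightarrow> small_subsets r XX"
    by blast
  moreover have "mono_on (small_subsets (cofinality r) (nonmax_ideals \<delta> XX)) f'"
    unfolding f'_def using mono_onD[OF mono image image] by (intro mono_onI image_mono) blast
  ultimately obtain \<sigma> where \<sigma>: "isotone_section \<delta> XX \<sigma>"
    "\<And>a b. a < b \<Longrightarrow> f' (\<sigma> ` {..a}) \<inter> \<sigma> ` {..b} \<subseteq> \<sigma> ` {..a}"
    using free_section by meson
  let ?\<tau> = "h \<circ> \<sigma>"
  have XX: "\<sigma> p \<in> XX" for p
    using section_in[OF \<sigma>(1)] .
  have "?\<tau> \<in> UNIV \<rightarrow> Field \<kappa>"
    using XX bij_betw_imp_surj_on[OF h] by auto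
  moreover have "inj ?\<tau>"
  proof (rule comp_inj_on[OF inj_section[OF \<sigma>(1)]])
    show "inj_on h (range \<sigma>)"
      using XX by (intro inj_on_subset[OF bij_betw_imp_inj_on[OF h]]) blast
  qed
  moreover have "f (?\<tau> ` {..a}) \<inter> ?\<tau> ` {..b} \<subseteq> ?\<tau> ` {..a}" if "a < b" for a b
  proof
    fix t
    assume t: "t \<in> f (?\<tau> ` {..a}) \<inter> ?\<tau> ` {..b}"
    then obtain c where c: "t = h (\<sigma> c)" "c \<le> b"
      by auto
    then have "?k t = \<sigma> c"
      using bij_betw_inv_into_left[OF h XX] by simp
    moreover have "?k t \<in> f' (\<sigma> ` {..a})"
      using t unfolding f'_def by (auto simp: image_comp)
    ultimately have "\<sigma> c \<in> \<sigma> ` {..a}"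
      using \<sigma>(2)[OF that] c(2) by auto
    then show "t \<in> ?\<tau> ` {..a}"
      using c(1) by auto
  qed
  ultimately show ?thesis
    by blast
qed

end

theorem mainTheorem13:
  fixes r :: "'l rel"
    and \<delta> :: "'x::order \<Rightarrow> 'p::order"
    and XX :: "'x set set"
    and \<kappa> :: "'k rel"
  assumes "Cinfinite r"
    and "lifter r \<delta> XX"
    and "Card_order \<kappa>" and "\<kappa> =o |XX|"
  shows
    "lower_small (cofinality r) (UNIV - maximal_elems UNIV :: 'p set) \<and>
     almost_join_semilattice (UNIV :: 'p set) \<and>
     (\<exists>C. finite C \<and> (\<forall>B \<in> C. with_zero B) \<and> disjoint_union_of (UNIV :: 'p set) C) \<and>
     (\<forall>f. f \<in> small_subsets (cofinality r) (nonmax_ideals \<delta> XX) \<rightarrow> small_subsets r XX \<and>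
          mono_on (small_subsets (cofinality r) (nonmax_ideals \<delta> XX)) f \<longrightarrow>
        (\<exists>\<sigma>. isotone_section \<delta> XX \<sigma> \<and>
          (\<forall>a b. a < b \<longrightarrow> f (\<sigma> ` {..a}) \<inter> \<sigma> ` {..b} \<subseteq> \<sigma> ` {..a}))) \<and>
     (\<forall>f. f \<in> small_subsets (cofinality r) (Field \<kappa>) \<rightarrow> small_subsets r (Field \<kappa>) \<and>
          mono_on (small_subsets (cofinality r) (Field \<kappa>)) f \<longrightarrow>
        (\<exists>\<sigma> :: 'p \<Rightarrow> 'k. \<sigma> \<in> UNIV \<rightarrow> Field \<kappa> \<and> inj \<sigma> \<and>
          (\<forall>a b. a < b \<longrightarrow> f (\<sigma> ` {..a}) \<inter> \<sigma> ` {..b} \<subseteq> \<sigma> ` {..a})))"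
proof -
  interpret lifter_of_poset r \<delta> XX
    using assms(1,2) by (rule lifter_of_poset.intro)
  show ?thesis
  proof (intro conjI allI impI)
    fix f
    assume "f \<in> small_subsets (cofinality r) (nonmax_ideals \<delta> XX) \<rightarrow> small_subsets r XX \<and>
        mono_on (small_subsets (cofinality r) (nonmax_ideals \<delta> XX)) f"
    then show "\<exists>\<sigma>. isotone_section \<delta> XX \<sigma> \<and>
        (\<forall>a b. a < b \<longrightarrow> f (\<sigma> ` {..a}) \<inter> \<sigma> ` {..b} \<subseteq> \<sigma> ` {..a})"
      by (elim conjE) (rule free_section)
  next
    fix f
    assume "f \<in> small_subsets (cofinality r) (Field \<kappa>) \<rightarrow> small_subsets r (Field \<kappa>) \<and>
        mono_on (small_subsets (cofinality r) (Field \<kappa>)) f"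
    then show "\<exists>\<tau> :: 'p \<Rightarrow> 'k. \<tau> \<in> UNIV \<rightarrow> Field \<kappa> \<and> inj \<tau> \<and>
        (\<forall>a b. a < b \<longrightarrow> f (\<tau> ` {..a}) \<inter> \<tau> ` {..b} \<subseteq> \<tau> ` {..a})"
      by (elim conjE) (rule free_injection[OF assms(3,4)])
  qed (fact lower_small_nonmaximal almost_join_semilattice_base disjoint_union_with_zero)+
qed

end
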